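(* Let $l,w\ge 1$ be integers and let $i\in\{1,2\}$. Let $\Sigma=\{e_1,e_2,\ldots,e_n\}\subset E_{l,w}^{(i)}$ be a subset of edges of the hammock network $H_{l,w}^{(i)}$ and let $\overline{\Sigma}=\{\bar e_1,\bar e_2,\ldots,\bar e_n\}\subset \overline{E_{l,w}^{(i)}}$ be the set of complementary edges. Then the following statements hold: (i) If $\Sigma$ is a mincut in $H_{l,w}^{(i)}$, then $\overline{\Sigma}$ is a minpath in the dual network $\overline{H_{l,w}^{(i)}}$. (ii) If $\Sigma$ is a minpath in $H_{l,w}^{(i)}$, then $\overline{\Sigma}$ is a mincut in the dual network $\overline{H_{l,w}^{(i)}}$.
   Context: Lattice points and edges. For integers $l,w\ge 1$, let $\mathcal{V}_{l,w}=\{A_{x,y}=(x,y)\in\mathbb{Z}^2: 0\le x\le l,\ 0\le y\le w\}$. Let $V_{l,w}^{(1)}$ (resp. $V_{l,w}^{(2)}$) be the subset of points $A_{x,y}\in\mathcal{V}_{l,w}$ with $x+y$ even (resp. odd). Let $\mathcal{E}_{l,w}$ be the set of all (undirected) line segments $A_{x,y}A_{x',y'}$ with $A_{x,y},A_{x',y'}\in\mathcal{V}_{l,w}$ and $|x-x'|=|y-y'|=1$. The endpoints of such a segment have coordinate sums of the same parity; $E_{l,w}^{(1)}$ (resp. $E_{l,w}^{(2)}$) is the set of segments $A_{x,y}A_{x',y'}\in\mathcal{E}_{l,w}$ with $x+y$ even (resp. odd). X-paths. An X-path is a sequence of pairwise distinct lattice points $v_0,v_1,\ldots,v_k\in\mathbb{Z}^2$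 with $v_j-v_{j-1}\in\{(1,1),(-1,1),(1,-1),(-1,-1)\}$ for $j=1,\ldots,k$; it is regarded as the set of the $k$ line segments $v_{j-1}v_j$. Hammock networks. For $i\in\{1,2\}$, the hammock network of kind $i$ and dimensions $(l,w)$ is the graph $H_{l,w}^{(i)}=(V_{l,w}^{(i)},E_{l,w}^{(i)})$, whose source nodes are the points $A_{0,y}\in V_{l,w}^{(i)}$ and whose terminus nodes are the points $A_{l,z}\in V_{l,w}^{(i)}$. Complementary edges and dual network. For an edge $e=A_{x,y}A_{x+1,y\pm1}\in\mathcal{E}_{l,w}$, its complementary edge is $\bar e=A_{x+1,y}A_{x,y\pm1}$ (the same choice of sign), i.e. the other diagonal of the same unit square. Put $\overline{V_{l,w}^{(i)}}=\mathcal{V}_{l,w}\setminus V_{l,w}^{(i)}=V_{l,w}^{(2/i)}$ and $\overline{E_{l,w}^{(i)}}=\mathcal{E}_{l,w}\setminus E_{l,w}^{(i)}=E_{l,w}^{(2/i)}$, where $2/i$ denotes $2$ if $i=1$ and $1$ if $i=2$. The dual network of $H_{l,w}^{(i)}$ is the graph $\overline{H_{l,w}^{(i)}}=(\overline{V_{l,w}^{(i)}},\overline{E_{l,w}^{(i)}})$, whose source nodes are the points $A_{x,0}\in\overline{V_{l,w}^{(i)}}$ and whose terminus nodes are the points $A_{z,w}\in\overline{V_{l,w}^{(i)}}$ (so the dual network is traversed from bottom to top, rather than from left to right). Pathsets and cutsets. In either type of network, with edge set $E$: a pathset is a subset of $E$ that contains (all the segments of) an X-path connecting a source node with a terminus node.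 A cutset is a subset $C\subset E$ such that $E\setminus C$ contains no X-path connecting a source node with a terminus node. A minpath is a pathset $P$ such that for every $e\in P$ the set $P\setminus\{e\}$ is not a pathset. A mincut is a cutset $C$ such that for every $e\in C$ the set $C\setminus\{e\}$ is not a cutset. *)

theory Defs
  imports Main "HOL-Library.Product_Plus"
begin

type_synonym point = "int \<times> int"

text \<open>A segment is undirected and is represented by the set of its two endpoints.\<close>

type_synonym segment = "point set"

record network =
  nodes :: "point set"
  edges :: "segment set"
  sources :: "point set"
  termini :: "point set"


definition lattice_points :: "int \<Rightarrow> int \<Rightarrow> point set" where
  "lattice_points l w = {(x, y). 0 \<le> x \<and> x \<le> l \<and> 0 \<le> y \<and> y \<le> w}"

definition lattice_edges :: "int \<Rightarrow> int \<Rightarrow> segment set" where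
  "lattice_edges l w =
     {{(x, y), (x', y')} | x y x' y'.
        (x, y) \<in> lattice_points l w \<and> (x', y') \<in> lattice_points l w \<and>
        \<bar>x - x'\<bar> = 1 \<and> \<bar>y - y'\<bar> = 1}"

text \<open>Kind \<open>1\<close> selects even coordinate sums and kind \<open>2\<close> odd ones; no other kind is used.\<close>

definition of_kind :: "nat \<Rightarrow> point \<Rightarrow> bool" where
  "of_kind i = (\<lambda>(x, y). if i = 1 then even (x + y) else odd (x + y))"

definition hammock_points :: "int \<Rightarrow> int \<Rightarrow> nat \<Rightarrow> point set" where
  "hammock_points l w i = {p \<in> lattice_points l w. of_kind i p}"

definition hammock_edges :: "int \<Rightarrow> int \<Rightarrow> nat \<Rightarrow> segment set" where
  "hammock_edges l w i =
     {{(x, y), (x', y')} | x y x' y'.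
        (x, y) \<in> lattice_points l w \<and> (x', y') \<in> lattice_points l w \<and>
        \<bar>x - x'\<bar> = 1 \<and> \<bar>y - y'\<bar> = 1 \<and> of_kind i (x, y)}"

definition hammock :: "int \<Rightarrow> int \<Rightarrow> nat \<Rightarrow> network" where
  "hammock l w i =
     \<lparr>nodes = hammock_points l w i,
      edges = hammock_edges l w i,
      sources = {(x, y) \<in> hammock_points l w i. x = 0},
      termini = {(x, y) \<in> hammock_points l w i. x = l}\<rparr>"

definition dual_hammock :: "int \<Rightarrow> int \<Rightarrow> nat \<Rightarrow> network" where
  "dual_hammock l w i =
     \<lparr>nodes = lattice_points l w - hammock_points l w i,
      edges = lattice_edges l w - hammock_edges l w i,
      sources = {(x, y) \<in> lattice_points l w - hammock_points l w i. y = 0},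
      termini = {(x, y) \<in> lattice_points l w - hammock_points l w i. y = w}\<rparr>"


text \<open>Meaningful only for diagonals of unit squares, where the description determines a unique
  segment; see \<open>compl_edge_eq\<close> below.\<close>

definition compl_edge :: "segment \<Rightarrow> segment" where
  "compl_edge e =
     (THE e'. \<exists>x y s. (s = 1 \<or> s = -1) \<and>
        e = {(x, y), (x + 1, y + s)} \<and> e' = {(x + 1, y), (x, y + s)})"


text \<open>A path is given by the list of its points \<open>v\<^sub>0, \<dots>, v\<^sub>k\<close>, with \<open>k = 0\<close> allowed.\<close>

definition xpath :: "point list \<Rightarrow> bool" where
  "xpath vs \<longleftrightarrow> vs \<noteq> [] \<and> distinct vs \<and>
     successively (\<lambda>u v. v - u \<in> {(1, 1), (-1, 1), (1, -1), (-1, -1)}) vs"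

definition path_segments :: "point list \<Rightarrow> segment set" where
  "path_segments vs = {{vs ! j, vs ! Suc j} | j. Suc j < length vs}"

definition contains_connecting_xpath :: "network \<Rightarrow> segment set \<Rightarrow> bool" where
  "contains_connecting_xpath N S \<longleftrightarrow>
     (\<exists>vs. xpath vs \<and> hd vs \<in> sources N \<and> last vs \<in> termini N \<and> path_segments vs \<subseteq> S)"

definition pathset :: "network \<Rightarrow> segment set \<Rightarrow> bool" where
  "pathset N P \<longleftrightarrow> P \<subseteq> edges N \<and> contains_connecting_xpath N P"

definition cutset :: "network \<Rightarrow> segment set \<Rightarrow> bool" where
  "cutset N C \<longleftrightarrow> C \<subseteq> edges N \<and> \<not> contains_connecting_xpath N (edges N - C)"

definition minpath :: "network \<Rightarrow> segment set \<Rightarrow> bool" where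
  "minpath N P \<longleftrightarrow> pathset N P \<and> (\<forall>e\<in>P. \<not> pathset N (P - {e}))"

definition mincut :: "network \<Rightarrow> segment set \<Rightarrow> bool" where
  "mincut N C \<longleftrightarrow> cutset N C \<and> (\<forall>e\<in>C. \<not> cutset N (C - {e}))"


lemma compl_edge_eq:
  assumes "s = 1 \<or> s = -1"
  shows "compl_edge {(x, y), (x + 1, y + s)} = {(x + 1, y), (x, y + s)}"
  unfolding compl_edge_def
  using assms by (intro the_equality) (auto simp: doubleton_eq_iff)

lemma of_kind_other:
  assumes "i \<in> {1, 2}"
  shows "of_kind (2 div i) p \<longleftrightarrow> \<not> of_kind i p"
  using assms by (auto simp: of_kind_def split: prod.splits)

lemma lattice_points_minus_hammock_points:
  assumes "i \<in> {1, 2}"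
  shows "lattice_points l w - hammock_points l w i = hammock_points l w (2 div i)"
  using of_kind_other[OF assms] by (auto simp: hammock_points_def)

lemma of_kind_diagonal:
  assumes "\<bar>x - x'\<bar> = 1" and "\<bar>y - y'\<bar> = 1"
  shows "of_kind i (x', y') \<longleftrightarrow> of_kind i (x, y)"
proof -
  have "x' = x + 1 \<or> x' = x - 1" "y' = y + 1 \<or> y' = y - 1"
    using assms by linarith+
  then show ?thesis
    by (auto simp: of_kind_def)
qed

lemma hammock_edges_alt:
  "hammock_edges l w i = {e \<in> lattice_edges l w. \<forall>p\<in>e. of_kind i p}"
  using of_kind_diagonal
  by (fastforce simp: hammock_edges_def lattice_edges_def)

lemma lattice_edges_minus_hammock_edges:
  assumes "i \<in> {1, 2}"
  shows "lattice_edges l w - hammock_edges l w i = hammock_edges l w (2 div i)"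
proof -
  have "(\<forall>p\<in>e. of_kind (2 div i) p) \<longleftrightarrow> \<not> (\<forall>p\<in>e. of_kind i p)"
    if "e \<in> lattice_edges l w" for e
    using that of_kind_diagonal of_kind_other[OF assms]
    by (fastforce simp: lattice_edges_def)
  then show ?thesis
    by (auto simp: hammock_edges_alt)
qed

end

theory Submission
  imports Defs
begin

text \<open>
  Choose a set \<open>S\<close> of edges of the hammock network, and in every unit square draw the diagonal of the
  network if it is in \<open>S\<close>, otherwise the complementary diagonal, which belongs to the dual network.
  The theorem rests on a planar duality for such drawings: they contain either a left-right path of
  the hammock network or a bottom-top path of the dual network, but not both
  (\<open>connecting_xpath_duality\<close>). For the complement of \<open>S\<close> in place of \<open>S\<close>, it says that \<open>S\<close> is a cutset
  exactly if its complementary edges form a dual pathset, and for \<open>S\<close> itself that \<open>S\<close> is a pathset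
  exactly if its complementary edges form a dual cutset. Passing to the complementary edge is a
  bijection between the edges of the two networks, so these equivalences carry over to \<open>S - {e}\<close>, and
  thus to minimal pathsets and cutsets.

  Both halves of the duality are arguments modulo \<open>2\<close>.

  At least one path exists (\<open>crossing_exists\<close>): mark the points of the hammock network reachable from
  the left, and the points of the dual network reachable from the bottom. The diagonal drawn in a
  square has both of its ends marked or neither, so the number of the four sides of the square with
  both ends marked is even. Summing over the squares, the number of boundary sides with both ends
  marked is even. If neither network were connected, the marks on the boundary would be known
  well enough to see that this number is odd (\<open>no_crossing_free_colouring\<close>).

  At most one path exists (\<open>crossings_exclude\<close>): this is a discrete Jordan curve argument. Given a
  bottom-top path, the parity of its crossings with the horizontal ray going left from a point tells
  the side of the path on which the point lies. This parity does not change along an edge whose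
  complementary edge is not used by the path; but it is even at the left end and odd at the right
  end of the rectangle.
\<close>

section \<open>Paths and their segments\<close>

lemma path_segments_simps [simp]:
  "path_segments [] = {}"
  "path_segments [u] = {}"
  "path_segments (u # v # vs) = insert {u, v} (path_segments (v # vs))"
proof -
  have "path_segments (u # v # vs) \<subseteq> insert {u, v} (path_segments (v # vs))"
  proof
    fix e assume "e \<in> path_segments (u # v # vs)"
    then obtain j where j: "Suc j < length (u # v # vs)"
        "e = {(u # v # vs) ! j, (u # v # vs) ! Suc j}"
      by (auto simp: path_segments_def)
    then show "e \<in> insert {u, v} (path_segments (v # vs))"
      by (cases j) (auto simp: path_segments_def)
  qed
  moreover have "{u, v} \<in> path_segments (u # v # vs)"
    unfolding path_segments_def by (rule CollectI, rule exI[of _ 0]) simp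
  moreover have "path_segments (v # vs) \<subseteq> path_segments (u # v # vs)"
  proof
    fix e assume "e \<in> path_segments (v # vs)"
    then obtain j where "Suc j < length (v # vs)" "e = {(v # vs) ! j, (v # vs) ! Suc j}"
      by (auto simp: path_segments_def)
    then show "e \<in> path_segments (u # v # vs)"
      unfolding path_segments_def by (intro CollectI exI[of _ "Suc j"]) simp
  qed
  ultimately show "path_segments (u # v # vs) = insert {u, v} (path_segments (v # vs))"
    by blast
qed (auto simp: path_segments_def)

lemma path_segments_append:
  "path_segments (us @ q # vs) = path_segments (us @ [q]) \<union> path_segments (q # vs)"
proof (induction us)
  case (Cons u us)
  then show ?case by (cases us) auto
qed simp

lemma path_segments_snoc:
  assumes "vs \<noteq> []"
  shows "path_segments (vs @ [q]) = insert {last vs, q} (path_segments vs)"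
proof -
  obtain us p where "vs = us @ [p]"
    using assms by (metis rev_exhaust)
  then show ?thesis
    using path_segments_append[of us p "[q]"] by auto
qed

definition connected_to :: "point set \<Rightarrow> segment set \<Rightarrow> point set" where
  "connected_to A S = {p. \<exists>vs. xpath vs \<and> hd vs \<in> A \<and> last vs = p \<and> path_segments vs \<subseteq> S}"

lemma contains_connecting_xpath_iff:
  "contains_connecting_xpath N S \<longleftrightarrow> connected_to (sources N) S \<inter> termini N \<noteq> {}"
  by (auto simp: contains_connecting_xpath_def connected_to_def)

lemma subset_connected_to: "A \<subseteq> connected_to A S"
proof
  fix p assume "p \<in> A"
  then have "xpath [p] \<and> hd [p] \<in> A \<and> last [p] = p \<and> path_segments [p] \<subseteq> S"
    by (simp add: xpath_def)
  then show "p \<in> connected_to A S"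
    unfolding connected_to_def by blast
qed

text \<open>A path that would revisit \<open>q\<close> is cut off at its first visit instead of being extended, so
  that its points stay distinct.\<close>

lemma connected_to_step:
  assumes "p \<in> connected_to A S" and "{p, q} \<in> S"
    and diag: "q - p \<in> {(1, 1), (-1, 1), (1, -1), (-1, -1)}"
  shows "q \<in> connected_to A S"
proof -
  obtain vs where vs: "xpath vs" "hd vs \<in> A" "last vs = p" "path_segments vs \<subseteq> S"
    using assms(1) by (auto simp: connected_to_def)
  show ?thesis
  proof (cases "q \<in> set vs")
    case True
    then obtain us ws where split: "vs = us @ q # ws"
      by (metis split_list)
    have "xpath (us @ [q])"
      using vs(1) by (auto simp: xpath_def split successively_append_iff)
    moreover have "hd (us @ [q]) \<in> A"
      using vs(2) by (cases us) (auto simp: split)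
    moreover have "path_segments (us @ [q]) \<subseteq> S"
      using vs(4) path_segments_append[of us q ws] by (simp add: split)
    ultimately show ?thesis
      unfolding connected_to_def by (intro CollectI exI[of _ "us @ [q]"]) simp
  next
    case False
    have "vs \<noteq> []"
      using vs(1) by (simp add: xpath_def)
    then have "xpath (vs @ [q])"
      using vs(1,3) False diag by (simp add: xpath_def successively_append_iff)
    moreover have "hd (vs @ [q]) \<in> A"
      using vs(2) \<open>vs \<noteq> []\<close> by simp
    moreover have "path_segments (vs @ [q]) \<subseteq> S"
      using vs(3,4) assms(2) path_segments_snoc[OF \<open>vs \<noteq> []\<close>] by simp
    ultimately show ?thesis
      unfolding connected_to_def by (intro CollectI exI[of _ "vs @ [q]"]) simp
  qed
qed

lemma diagonal_connected:
  assumes "{p, q} \<in> S" and "q - p \<in> {(1, 1), (-1, 1), (1, -1), (-1, -1)}"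
  shows "p \<in> connected_to A S \<longleftrightarrow> q \<in> connected_to A S"
proof -
  have "{q, p} \<in> S"
    using assms(1) by (simp add: insert_commute)
  moreover have "p - q \<in> {(1, 1), (-1, 1), (1, -1), (-1, -1)}"
    using assms(2) by (cases p; cases q) auto
  ultimately show ?thesis
    using connected_to_step assms by blast
qed


section \<open>Complementary edges\<close>

lemma hammock_edgeI:
  assumes "s = 1 \<or> s = -1"
    and "(x, y) \<in> hammock_points l w i" and "(x + 1, y + s) \<in> hammock_points l w i"
  shows "{(x, y), (x + 1, y + s)} \<in> hammock_edges l w i"
  unfolding hammock_edges_def mem_Collect_eq
  apply (rule exI[of _ x], rule exI[of _ y], rule exI[of _ "x + 1"], rule exI[of _ "y + s"])
  using assms by (auto simp: hammock_points_def)

lemma hammock_edgeE: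
  assumes "e \<in> hammock_edges l w i"
  obtains x y s where "s = 1 \<or> s = -1" and "e = {(x, y), (x + 1, y + s)}"
    and "(x, y) \<in> hammock_points l w i" and "(x + 1, y + s) \<in> hammock_points l w i"
proof -
  obtain x y x' y' where e: "e = {(x, y), (x', y')}"
    and pts: "(x, y) \<in> lattice_points l w" "(x', y') \<in> lattice_points l w"
    and d: "\<bar>x - x'\<bar> = 1" "\<bar>y - y'\<bar> = 1" and k: "of_kind i (x, y)"
    using assms unfolding hammock_edges_def mem_Collect_eq by (elim exE conjE)
  have H: "(x, y) \<in> hammock_points l w i" "(x', y') \<in> hammock_points l w i"
    using pts k of_kind_diagonal[OF d] by (auto simp: hammock_points_def)
  have "x' = x + 1 \<or> x = x' + 1"
    using d(1) by linarith
  then show thesis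
  proof
    assume "x' = x + 1"
    then show thesis
      using e H d(2) that[of "y' - y" x y] by simp linarith
  next
    assume "x = x' + 1"
    then show thesis
      using e H d(2) that[of "y - y'" x' y'] by (simp add: insert_commute) linarith
  qed
qed

lemma compl_edge_hammock_edge:
  assumes "e \<in> hammock_edges l w i" and "i \<in> {1, 2}"
  shows "compl_edge e \<in> hammock_edges l w (2 div i)" and "compl_edge (compl_edge e) = e"
proof -
  obtain x y s where s: "s = 1 \<or> s = -1" and e: "e = {(x, y), (x + 1, y + s)}"
    and H: "(x, y) \<in> hammock_points l w i" "(x + 1, y + s) \<in> hammock_points l w i"
    using assms(1) by (rule hammock_edgeE)
  have ce: "compl_edge e = {(x, y + s), (x + 1, (y + s) + - s)}"
    using compl_edge_eq[OF s] by (auto simp: e)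
  have "(x, y + s) \<in> hammock_points l w (2 div i)" "(x + 1, y) \<in> hammock_points l w (2 div i)"
    using H s assms(2)
    by (auto simp: hammock_points_def lattice_points_def of_kind_def)
  then show "compl_edge e \<in> hammock_edges l w (2 div i)"
    using hammock_edgeI[of "- s" x "y + s"] s by (auto simp: ce)
  have "- s = 1 \<or> - s = -1"
    using s by auto
  then show "compl_edge (compl_edge e) = e"
    unfolding ce using compl_edge_eq[of "- s" x "y + s"] by (auto simp: e)
qed

lemma bij_betw_compl_edge:
  assumes "i \<in> {1, 2}"
  shows "bij_betw compl_edge (hammock_edges l w i) (hammock_edges l w (2 div i))"
proof (rule bij_betw_byWitness[where f' = compl_edge])
  have j: "2 div i \<in> {1, 2}" "2 div (2 div i) = i"
    using assms by auto
  show "compl_edge ` hammock_edges l w i \<subseteq> hammock_edges l w (2 div i)"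
    using compl_edge_hammock_edge(1)[OF _ assms] by auto
  show "compl_edge ` hammock_edges l w (2 div i) \<subseteq> hammock_edges l w i"
    using compl_edge_hammock_edge(1)[OF _ j(1)] j(2) by auto
  show "\<forall>e\<in>hammock_edges l w i. compl_edge (compl_edge e) = e"
    using compl_edge_hammock_edge(2)[OF _ assms] by blast
  show "\<forall>e\<in>hammock_edges l w (2 div i). compl_edge (compl_edge e) = e"
    using compl_edge_hammock_edge(2)[OF _ j(1)] by blast
qed

lemma hammock_sel:
  "edges (hammock l w i) = hammock_edges l w i"
  "sources (hammock l w i) = {(x, y) \<in> hammock_points l w i. x = 0}"
  "termini (hammock l w i) = {(x, y) \<in> hammock_points l w i. x = l}"
  by (simp_all add: hammock_def)

lemma dual_hammock_sel:
  assumes "i \<in> {1, 2}"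
  shows "edges (dual_hammock l w i) = hammock_edges l w (2 div i)"
    and "sources (dual_hammock l w i) = {(x, y) \<in> hammock_points l w (2 div i). y = 0}"
    and "termini (dual_hammock l w i) = {(x, y) \<in> hammock_points l w (2 div i). y = w}"
  by (simp_all add: dual_hammock_def lattice_edges_minus_hammock_edges[OF assms]
      lattice_points_minus_hammock_points[OF assms])


section \<open>At least one of the two networks is connected\<close>

lemma even_telescope:
  fixes g :: "nat \<Rightarrow> nat"
  shows "even (\<Sum>k<n. g k + g (Suc k)) \<longleftrightarrow> even (g 0 + g n)"
  by (induction n) auto

text \<open>This is the parity argument behind the existence of a crossing. If a square has corner values
  \<open>a, b, c, d \<in> {0, 1}\<close>, with \<open>a\<close> opposite to \<open>d\<close>, the hypothesis says that
  \<open>(a + d) * (b + c)\<close> is even. Multiplied out, this is the sum, over the four sides of the square,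
  of the product of the two end values. In the sum over all squares every inner side occurs twice,
  so the same sum over the boundary sides is even. But on the boundary it equals
  \<open>f 0 0 = 1\<close> modulo \<open>2\<close>: along the top and the right every product vanishes, and along the bottom
  and the left every second factor is \<open>1\<close>, so that the products telescope.\<close>

lemma no_crossing_free_colouring:
  fixes f H :: "nat \<Rightarrow> nat \<Rightarrow> bool"
  assumes square: "\<And>x y. x < l \<Longrightarrow> y < w \<Longrightarrow>
      f x y = f (Suc x) (Suc y) \<or> f (Suc x) y = f x (Suc y)"
    and H: "\<And>x y. H (Suc x) y = (\<not> H x y)" "\<And>x y. H x (Suc y) = (\<not> H x y)"
    and left: "\<And>y. y \<le> w \<Longrightarrow> H 0 y \<Longrightarrow> f 0 y"
    and right: "\<And>y. y \<le> w \<Longrightarrow> H l y \<Longrightarrow> \<not> f l y"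
    and bottom: "\<And>x. x \<le> l \<Longrightarrow> \<not> H x 0 \<Longrightarrow> f x 0"
    and top: "\<And>x. x \<le> l \<Longrightarrow> \<not> H x w \<Longrightarrow> \<not> f x w"
  shows False
proof -
  define h v :: "nat \<Rightarrow> nat \<Rightarrow> nat" where
    "h x y = of_bool (f x y \<and> f (Suc x) y)" and "v x y = of_bool (f x y \<and> f x (Suc y))" for x y
  have "even ((h x y + h x (Suc y)) + (v x y + v (Suc x) y))" if "x < l" "y < w" for x y
    using square[OF that] by (auto simp: h_def v_def)
  then have "even (\<Sum>x<l. \<Sum>y<w. (h x y + h x (Suc y)) + (v x y + v (Suc x) y))"
    by (intro dvd_sum) auto
  also have "(\<Sum>x<l. \<Sum>y<w. (h x y + h x (Suc y)) + (v x y + v (Suc x) y)) =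
      (\<Sum>x<l. \<Sum>y<w. h x y + h x (Suc y)) + (\<Sum>y<w. \<Sum>x<l. v x y + v (Suc x) y)"
    using sum.swap[of "\<lambda>x y. v x y + v (Suc x) y" "{..<w}" "{..<l}"]
    by (simp only: sum.distrib[of "\<lambda>x. \<Sum>y<w. h x y + h x (Suc y)"]
        sum.distrib[of "\<lambda>y. h _ y + h _ (Suc y)"])
  also have "even \<dots> \<longleftrightarrow> even ((\<Sum>x<l. h x 0 + h x w) + (\<Sum>y<w. v 0 y + v l y))"
  proof -
    have "even (\<Sum>x<l. \<Sum>y<w. h x y + h x (Suc y)) \<longleftrightarrow> even (\<Sum>x<l. h x 0 + h x w)" for l
      by (induction l) (auto simp: even_telescope)
    moreover have
      "even (\<Sum>y<w. \<Sum>x<l. v x y + v (Suc x) y) \<longleftrightarrow> even (\<Sum>y<w. v 0 y + v l y)" for w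
      by (induction w) (auto simp: even_telescope[of "\<lambda>x. v x _"])
    ultimately show ?thesis
      by simp
  qed
  finally have boundary: "even ((\<Sum>x<l. h x 0 + h x w) + (\<Sum>y<w. v 0 y + v l y))" .
  define b s :: "nat \<Rightarrow> nat" where
    "b x = of_bool (H x 0 \<and> f x 0)" and "s y = of_bool (\<not> H 0 y \<and> f 0 y)" for x y
  have "h x 0 + h x w = b x + b (Suc x)" if "x < l" for x
    using that H(1)[of x 0] H(1)[of x w] bottom[of x] bottom[of "Suc x"] top[of x] top[of "Suc x"]
    by (auto simp: h_def b_def)
  then have "even (\<Sum>x<l. h x 0 + h x w) \<longleftrightarrow> even (b 0 + b l)"
    using even_telescope[of b l] by simp
  moreover have "v 0 y + v l y = s y + s (Suc y)" if "y < w" for y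
    using that H(2)[of 0 y] H(2)[of l y] left[of y] left[of "Suc y"] right[of y] right[of "Suc y"]
    by (auto simp: v_def s_def)
  then have "even (\<Sum>y<w. v 0 y + v l y) \<longleftrightarrow> even (s 0 + s w)"
    using even_telescope[of s w] by simp
  moreover have "b l = 0" "s w = 0"
    using right[of 0] top[of 0] by (auto simp: b_def s_def)
  moreover have "odd (b 0 + s 0)"
    using left[of 0] bottom[of 0] by (auto simp: b_def s_def)
  ultimately show False
    using boundary by simp
qed

text \<open>Otherwise the following marking would be such a colouring: mark the points reachable from the sources, in either network, along the chosen edges. Every
  unit square has a chosen diagonal, whose ends are then both marked or both unmarked.\<close>

lemma crossing_exists:
  assumes lw: "l \<ge> 1" "w \<ge> 1" and i: "i \<in> {1, 2}"
  shows "contains_connecting_xpath (hammock l w i) S \<or>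
    contains_connecting_xpath (dual_hammock l w i) (compl_edge ` (hammock_edges l w i - S))"
proof (rule ccontr)
  assume no: "\<not> ?thesis"
  define D where "D = compl_edge ` (hammock_edges l w i - S)"
  define R where "R = connected_to {(x, y) \<in> hammock_points l w i. x = 0} S"
  define T where "T = connected_to {(x, y) \<in> hammock_points l w (2 div i). y = 0} D"
  define f where "f p \<longleftrightarrow> (if of_kind i p then p \<in> R else p \<in> T)" for p
  have square: "f (x, y) = f (x + 1, y + 1) \<or> f (x + 1, y) = f (x, y + 1)"
    if xy: "0 \<le> x" "x < l" "0 \<le> y" "y < w" for x y
  proof -
    define e where "e = {(x, y), (x + 1, y + 1)}"
    define e' where "e' = {(x, y + 1), (x + 1, y)}"
    have ce: "compl_edge e = e'" "compl_edge e' = e"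
      using compl_edge_eq[of 1 x y] compl_edge_eq[of "-1" x "y + 1"]
      by (auto simp: e_def e'_def)
    have pt: "(x, y) \<in> lattice_points l w" "(x + 1, y) \<in> lattice_points l w"
      "(x, y + 1) \<in> lattice_points l w" "(x + 1, y + 1) \<in> lattice_points l w"
      using xy by (auto simp: lattice_points_def)
    show ?thesis
    proof (cases "of_kind i (x, y)")
      case True
      then have kinds: "of_kind i (x + 1, y + 1)" "\<not> of_kind i (x + 1, y)" "\<not> of_kind i (x, y + 1)"
        using i by (auto simp: of_kind_def)
      have "e \<in> hammock_edges l w i"
        using hammock_edgeI[of 1 x y] True kinds pt by (simp add: e_def hammock_points_def)
      then have "e \<in> S \<or> e' \<in> D"
        using ce by (auto simp: D_def)
      then show ?thesis
        using diagonal_connected[of "(x, y)" "(x + 1, y + 1)" S]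
          diagonal_connected[of "(x, y + 1)" "(x + 1, y)" D] True kinds
        by (auto simp: f_def R_def T_def e_def e'_def)
    next
      case False
      then have kinds: "\<not> of_kind i (x + 1, y + 1)" "of_kind i (x + 1, y)" "of_kind i (x, y + 1)"
        using i by (auto simp: of_kind_def)
      have "e' \<in> hammock_edges l w i"
        using hammock_edgeI[of "-1" x "y + 1"] kinds pt by (simp add: e'_def hammock_points_def)
      then have "e' \<in> S \<or> e \<in> D"
        using ce by (auto simp: D_def)
      then show ?thesis
        using diagonal_connected[of "(x, y)" "(x + 1, y + 1)" D]
          diagonal_connected[of "(x, y + 1)" "(x + 1, y)" S] False kinds
        by (auto simp: f_def R_def T_def e_def e'_def)
    qed
  qed
  have pts: "(x, y) \<in> hammock_points l w (if of_kind i (x, y) then i else 2 div i)"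
    if "0 \<le> x" "x \<le> l" "0 \<le> y" "y \<le> w" for x y
    using that of_kind_other[OF i] by (auto simp: hammock_points_def lattice_points_def)
  have left: "f (0, y)" if "0 \<le> y" "y \<le> w" "of_kind i (0, y)" for y
    using that pts[of 0 y] lw subset_connected_to by (fastforce simp: f_def R_def)
  have bottom: "f (x, 0)" if "0 \<le> x" "x \<le> l" "\<not> of_kind i (x, 0)" for x
    using that pts[of x 0] lw subset_connected_to by (fastforce simp: f_def T_def)
  have right: "\<not> f (l, y)" if "0 \<le> y" "y \<le> w" "of_kind i (l, y)" for y
    using that pts[of l y] lw no
    by (auto simp: f_def R_def contains_connecting_xpath_iff hammock_sel)
  have top: "\<not> f (x, w)" if "0 \<le> x" "x \<le> l" "\<not> of_kind i (x, w)" for x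
    using that pts[of x w] lw no
    by (auto simp: f_def T_def D_def contains_connecting_xpath_iff dual_hammock_sel[OF i])
  obtain L W where LW: "l = int L" "w = int W"
    using lw by (metis nonneg_int_cases order.trans zero_le_one)
  show False
  proof (rule no_crossing_free_colouring[where l = L and w = W
        and f = "\<lambda>x y. f (int x, int y)" and H = "\<lambda>x y. of_kind i (int x, int y)"])
    show "f (int x, int y) = f (int (Suc x), int (Suc y)) \<or>
        f (int (Suc x), int y) = f (int x, int (Suc y))" if "x < L" "y < W" for x y
      using square[of "int x" "int y"] that LW by (simp add: add.commute)
  qed (use left right bottom top LW in \<open>auto simp: of_kind_def\<close>)
qed


section \<open>At most one of the two networks is connected\<close>

lemma xpath_points:
  assumes "successively r vs" and "vs \<noteq> []" and "hd vs \<in> hammock_points l w k"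
    and "path_segments vs \<subseteq> hammock_edges l w k"
  shows "set vs \<subseteq> hammock_points l w k"
  using assms
proof (induction vs rule: induct_list012)
  case (3 u v vs)
  have "\<forall>p\<in>{u, v}. p \<in> hammock_points l w k"
    using "3.prems"(4) by (auto elim!: hammock_edgeE simp: doubleton_eq_iff)
  then show ?case
    using "3.IH"(2) "3.prems" by auto
qed auto

text \<open>The parity of the number of steps of a path that meet the horizontal ray running left from
  \<open>(x, y + 1/2)\<close>: such a step lies in a unit square of the row between \<open>y\<close> and \<open>y + 1\<close>, and in one
  of the columns left of \<open>x\<close>.\<close>

fun odd_crossings :: "int \<Rightarrow> int \<Rightarrow> point list \<Rightarrow> bool" where
  "odd_crossings x y (u # v # vs) \<longleftrightarrow>
     (min (snd u) (snd v) = y \<and> min (fst u) (fst v) < x) \<noteq> odd_crossings x y (v # vs)"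
| "odd_crossings x y vs \<longleftrightarrow> False"

abbreviation diagonal_steps :: "point list \<Rightarrow> bool" where
  "diagonal_steps \<equiv> successively (\<lambda>u v. v - u \<in> {(1, 1), (-1, 1), (1, -1), (-1, -1)})"

text \<open>Lowering the ray past the height \<open>y\<close> changes the count by the steps that touch a point of the
  path at this height left of \<open>x\<close>. At an inner point of the path two steps meet, at each end only
  one, so modulo \<open>2\<close> only the ends remain. At the excluded point \<open>(x, y)\<close> a
  path could have one step left and one step right of the abscissa \<open>x\<close>, which would break this
  pairing.\<close>

lemma odd_crossings_lower:
  assumes "diagonal_steps vs" and "vs \<noteq> []" and "(x, y) \<notin> set vs"
  shows "odd_crossings x y vs \<noteq> odd_crossings x (y - 1) vs \<longleftrightarrow>
    (snd (hd vs) = y \<and> fst (hd vs) < x) \<noteq> (snd (last vs) = y \<and> fst (last vs) < x)"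
  using assms
proof (induction vs rule: induct_list012)
  case (3 u v vs)
  have step: "v - u \<in> {(1, 1), (-1, 1), (1, -1), (-1, -1)}"
    using "3.prems" by simp
  obtain a b c d where uv: "u = (a, b)" "v = (c, d)"
    by (metis surj_pair)
  have "((min b d = y \<and> min a c < x) \<noteq> (min b d = y - 1 \<and> min a c < x)) \<longleftrightarrow>
      ((b = y \<and> a < x) \<noteq> (d = y \<and> c < x))"
    using step "3.prems"(3) by (auto simp: uv)
  moreover have "odd_crossings x y (v # vs) \<noteq> odd_crossings x (y - 1) (v # vs) \<longleftrightarrow>
    (snd v = y \<and> fst v < x) \<noteq> (snd (last (v # vs)) = y \<and> fst (last (v # vs)) < x)"
    using "3.IH"(2) "3.prems" by simp
  ultimately show ?case
    by (simp only: uv odd_crossings.simps list.sel last.simps list.simps fst_conv snd_conv if_False)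
      argo
qed auto

lemma odd_crossings_full_row:
  assumes "diagonal_steps vs" and "vs \<noteq> []" and "\<forall>p\<in>set vs. fst p \<le> l"
  shows "odd_crossings l y vs \<longleftrightarrow> (snd (hd vs) \<le> y) \<noteq> (snd (last vs) \<le> y)"
  using assms
proof (induction vs rule: induct_list012)
  case (3 u v vs)
  obtain a b c d where uv: "u = (a, b)" "v = (c, d)"
    by (metis surj_pair)
  have "(min b d = y \<and> min a c < l) \<longleftrightarrow> (b \<le> y) \<noteq> (d \<le> y)"
    using "3.prems" by (auto simp: uv)
  moreover have "odd_crossings l y (v # vs) \<longleftrightarrow> (snd v \<le> y) \<noteq> (snd (last (v # vs)) \<le> y)"
    using "3.IH"(2) "3.prems" by simp
  ultimately show ?case
    by (simp only: uv odd_crossings.simps list.sel last.simps list.simps fst_conv snd_conv if_False)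
      argo
qed auto

lemma odd_crossings_empty_row:
  assumes "\<forall>p\<in>set vs. x \<le> fst p \<or> snd p < y"
  shows "\<not> odd_crossings x y vs"
  using assms
  by (induction vs rule: induct_list012) (auto simp: min_def split: if_splits)

lemma odd_crossings_next_column:
  assumes "diagonal_steps vs"
    and "{(x, y), (x + 1, y + 1)} \<notin> path_segments vs"
    and "{(x, y + 1), (x + 1, y)} \<notin> path_segments vs"
  shows "odd_crossings (x + 1) y vs = odd_crossings x y vs"
  using assms
proof (induction vs rule: induct_list012)
  case (3 u v vs)
  obtain a b c d where uv: "u = (a, b)" "v = (c, d)"
    by (metis surj_pair)
  have "\<not> (min b d = y \<and> min a c = x)"
  proof
    assume min: "min b d = y \<and> min a c = x"
    have steps: "c = a + 1 \<or> a = c + 1" "d = b + 1 \<or> b = d + 1"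
      using "3.prems"(1) by (auto simp: uv)
    have "a = x \<and> c = x + 1 \<or> a = x + 1 \<and> c = x" "b = y \<and> d = y + 1 \<or> b = y + 1 \<and> d = y"
      using min steps by (auto simp: min_def)
    then have "{u, v} = {(x, y), (x + 1, y + 1)} \<or> {u, v} = {(x, y + 1), (x + 1, y)}"
      by (elim disjE conjE) (simp_all add: uv insert_commute)
    then show False
      using "3.prems"(2,3) by (metis insertI1 path_segments_simps(3))
  qed
  then have "(min b d = y \<and> min a c < x + 1) \<longleftrightarrow> (min b d = y \<and> min a c < x)"
    by auto
  moreover have "odd_crossings (x + 1) y (v # vs) = odd_crossings x y (v # vs)"
    using "3.IH"(2) "3.prems" by simp
  ultimately show ?case
    by (simp add: uv)
qed auto

lemma constant_along_path:
  assumes "\<And>p q. {p, q} \<in> path_segments vs \<Longrightarrow> \<phi> p = \<phi> q" and "vs \<noteq> []"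
  shows "\<phi> (hd vs) = \<phi> (last vs)"
  using assms
proof (induction vs rule: induct_list012)
  case (3 u v vs)
  have "\<phi> u = \<phi> v"
    by (rule "3.prems"(1)) simp
  moreover have "\<phi> (hd (v # vs)) = \<phi> (last (v # vs))"
    by (rule "3.IH"(2)) (simp_all add: "3.prems"(1))
  ultimately show ?case
    by simp
qed simp_all

text \<open>The crossing parity relative to a bottom-top path \<open>ws\<close> is used as a potential on the points of the
  hammock network. An edge spans one row of squares, and its two ends can both be joined to rays in
  this row: the ray at its lower end directly, the one at its upper end after lowering it. The two
  rays differ by a single square, in which \<open>ws\<close> has no step.\<close>

lemma crossings_exclude:
  assumes lw: "l \<ge> 1" "w \<ge> 1" and i: "i \<in> {1, 2}" and S: "S \<subseteq> hammock_edges l w i"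
  shows "\<not> (contains_connecting_xpath (hammock l w i) S \<and>
    contains_connecting_xpath (dual_hammock l w i) (compl_edge ` (hammock_edges l w i - S)))"
proof
  define D where "D = compl_edge ` (hammock_edges l w i - S)"
  assume "contains_connecting_xpath (hammock l w i) S \<and>
    contains_connecting_xpath (dual_hammock l w i) (compl_edge ` (hammock_edges l w i - S))"
  then obtain vs ws where
      vs: "xpath vs" "hd vs \<in> sources (hammock l w i)" "last vs \<in> termini (hammock l w i)"
        "path_segments vs \<subseteq> S"
    and ws: "xpath ws" "hd ws \<in> sources (dual_hammock l w i)"
        "last ws \<in> termini (dual_hammock l w i)" "path_segments ws \<subseteq> D"
    unfolding contains_connecting_xpath_def D_def by blast
  have ws_steps: "diagonal_steps ws" "ws \<noteq> []" and "vs \<noteq> []"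
    using vs(1) ws(1) by (auto simp: xpath_def)
  have hd_ws: "snd (hd ws) = 0" and last_ws: "snd (last ws) = w"
    using ws(2,3) by (auto simp: dual_hammock_sel[OF i])
  have "D \<subseteq> hammock_edges l w (2 div i)"
    using bij_betw_compl_edge[OF i, of l w] by (auto simp: D_def bij_betw_def)
  then have segs_ws: "path_segments ws \<subseteq> hammock_edges l w (2 div i)"
    using ws(4) by blast
  moreover have "hd ws \<in> hammock_points l w (2 div i)"
    using ws(2) by (auto simp: dual_hammock_sel[OF i])
  ultimately have "set ws \<subseteq> hammock_points l w (2 div i)"
    using xpath_points[OF ws_steps] by blast
  then have ws_dual: "\<forall>p\<in>set ws. of_kind (2 div i) p"
    and ws_lattice: "\<forall>p\<in>set ws. 0 \<le> fst p \<and> fst p \<le> l \<and> 0 \<le> snd p \<and> snd p \<le> w"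
    by (auto simp: hammock_points_def lattice_points_def)
  \<comment> \<open>This tells on which side of \<open>ws\<close> a point lies. The second part counts a crossing with a
    prolongation of \<open>ws\<close> upwards beyond the rectangle: no step of \<open>ws\<close> lies above the height \<open>w\<close>.\<close>
  define \<phi> where "\<phi> = (\<lambda>(x, y). odd_crossings x y ws \<noteq> (y = w \<and> fst (last ws) < x))"
  have lower: "odd_crossings x y ws = \<phi> (x, y)" if "y < w" for x y
    using that by (simp add: \<phi>_def)
  have upper: "odd_crossings x y ws = \<phi> (x, y + 1)"
    if "(x, y + 1) \<in> hammock_points l w i" "0 \<le> y" for x y
  proof -
    have "(x, y + 1) \<notin> set ws"
      using that ws_dual of_kind_other[OF i] by (auto simp: hammock_points_def)
    then show ?thesis
      using odd_crossings_lower[OF ws_steps, of x "y + 1"] hd_ws last_ws that(2)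
      by (auto simp: \<phi>_def)
  qed
  have step: "\<phi> p = \<phi> q" if "{p, q} \<in> S" for p q
  proof -
    have "{p, q} \<in> hammock_edges l w i"
      using that S by auto
    then obtain x y s where s: "s = 1 \<or> s = -1" and e: "{p, q} = {(x, y), (x + 1, y + s)}"
      and pts: "(x, y) \<in> hammock_points l w i" "(x + 1, y + s) \<in> hammock_points l w i"
      by (rule hammock_edgeE)
    have "{p, q} \<notin> path_segments ws"
    proof
      assume "{p, q} \<in> path_segments ws"
      then have "{p, q} \<in> hammock_edges l w (2 div i)"
        using segs_ws by blast
      then have "of_kind (2 div i) (x, y)"
        unfolding hammock_edges_alt e by blast
      then show False
        using pts(1) of_kind_other[OF i] by (auto simp: hammock_points_def)
    qed
    moreover have "compl_edge {p, q} \<notin> path_segments ws"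
    proof
      assume "compl_edge {p, q} \<in> path_segments ws"
      then obtain e' where "e' \<in> hammock_edges l w i - S" "compl_edge {p, q} = compl_edge e'"
        using ws(4) by (auto simp: D_def)
      then show False
        using bij_betw_compl_edge[OF i, of l w] that S
        by (metis DiffD1 DiffD2 bij_betw_imp_inj_on inj_onD subsetD)
    qed
    ultimately have segs: "{(x, y), (x + 1, y + s)} \<notin> path_segments ws"
      "{(x + 1, y), (x, y + s)} \<notin> path_segments ws"
      using compl_edge_eq[OF s] by (auto simp: e)
    have "\<phi> (x, y) = \<phi> (x + 1, y + s)"
      using s
    proof
      assume s1: "s = 1"
      have "odd_crossings (x + 1) y ws = odd_crossings x y ws"
        using odd_crossings_next_column[OF ws_steps(1), of x y] segs
        by (simp add: s1 insert_commute)
      then show ?thesis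
        using lower[of y x] upper[of "x + 1" y] pts
        by (simp add: s1 hammock_points_def lattice_points_def)
    next
      assume s1: "s = -1"
      have "odd_crossings (x + 1) (y - 1) ws = odd_crossings x (y - 1) ws"
        using odd_crossings_next_column[OF ws_steps(1), of x "y - 1"] segs
        by (simp add: s1 insert_commute)
      then show ?thesis
        using lower[of "y - 1" "x + 1"] upper[of x "y - 1"] pts
        by (simp add: s1 hammock_points_def lattice_points_def)
    qed
    then show ?thesis
      using e by (auto simp: doubleton_eq_iff)
  qed
  have "\<phi> (hd vs) = \<phi> (last vs)"
    using constant_along_path[of vs \<phi>] step vs(4) \<open>vs \<noteq> []\<close> by blast
  moreover have "\<not> \<phi> (hd vs)"
  proof -
    obtain y where "hd vs = (0, y)"
      using vs(2) by (auto simp: hammock_sel)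
    moreover have "0 \<le> fst (last ws)"
      using ws_lattice ws_steps(2) by auto
    moreover have "\<not> odd_crossings 0 y ws"
      using ws_lattice by (intro odd_crossings_empty_row) auto
    ultimately show ?thesis
      by (simp add: \<phi>_def)
  qed
  moreover have "\<phi> (last vs)"
  proof -
    obtain y where y: "last vs = (l, y)" "(l, y) \<in> hammock_points l w i"
      using vs(3) by (auto simp: hammock_sel)
    have "odd_crossings l y ws \<longleftrightarrow> y < w"
      using odd_crossings_full_row[OF ws_steps, of l y] ws_lattice hd_ws last_ws y(2)
      by (auto simp: hammock_points_def lattice_points_def)
    moreover have "fst (last ws) < l" if "y = w"
    proof -
      \<comment> \<open>The corner \<open>(l, w)\<close> has the kind of \<open>vs\<close> here, so \<open>ws\<close> cannot end in it.\<close>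
      have "last ws \<noteq> (l, w)"
        using ws_dual ws_steps(2) y(2) that of_kind_other[OF i]
        by (metis (no_types, lifting) hammock_points_def last_in_set mem_Collect_eq)
      then have "fst (last ws) \<noteq> l"
        using last_ws by (metis prod.collapse)
      moreover have "fst (last ws) \<le> l"
        using ws_lattice ws_steps(2) by auto
      ultimately show ?thesis
        by simp
    qed
    ultimately show ?thesis
      using y by (auto simp: \<phi>_def hammock_points_def lattice_points_def)
  qed
  ultimately show False
    by simp
qed


section \<open>Duality of pathsets and cutsets\<close>

lemma connecting_xpath_duality:
  assumes "l \<ge> 1" "w \<ge> 1" "i \<in> {1, 2}" "S \<subseteq> hammock_edges l w i"
  shows "contains_connecting_xpath (hammock l w i) S \<longleftrightarrow>
    \<not> contains_connecting_xpath (dual_hammock l w i) (compl_edge ` (hammock_edges l w i - S))"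
  using crossing_exists[OF assms(1-3)] crossings_exclude[OF assms] by blast

context
  fixes l w :: int and i :: nat and S :: "segment set"
  assumes lw: "l \<ge> 1" "w \<ge> 1" and i: "i \<in> {1, 2}" and S: "S \<subseteq> hammock_edges l w i"
begin

lemma cutset_iff_dual_pathset:
  "cutset (hammock l w i) S \<longleftrightarrow> pathset (dual_hammock l w i) (compl_edge ` S)"
proof -
  have "hammock_edges l w i - (hammock_edges l w i - S) = S"
    using S by blast
  moreover have "compl_edge ` S \<subseteq> hammock_edges l w (2 div i)"
    using bij_betw_compl_edge[OF i, of l w] S by (auto simp: bij_betw_def)
  ultimately show ?thesis
    using connecting_xpath_duality[OF lw i, of "hammock_edges l w i - S"] S
    by (simp add: cutset_def pathset_def hammock_sel dual_hammock_sel[OF i])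
qed

lemma pathset_iff_dual_cutset:
  "pathset (hammock l w i) S \<longleftrightarrow> cutset (dual_hammock l w i) (compl_edge ` S)"
proof -
  have bij: "bij_betw compl_edge (hammock_edges l w i) (hammock_edges l w (2 div i))"
    by (rule bij_betw_compl_edge[OF i])
  then have "compl_edge ` (hammock_edges l w i - S) =
      hammock_edges l w (2 div i) - compl_edge ` S"
    using S by (metis bij_betw_def inj_on_image_set_diff order_refl Diff_subset)
  moreover have "compl_edge ` S \<subseteq> hammock_edges l w (2 div i)"
    using bij S by (auto simp: bij_betw_def)
  ultimately show ?thesis
    using connecting_xpath_duality[OF lw i S] S
    by (simp add: cutset_def pathset_def hammock_sel dual_hammock_sel[OF i])
qed

end

theorem theorem1:
  fixes l w :: int and i :: nat and \<Sigma> :: "segment set"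
  assumes "l \<ge> 1" and "w \<ge> 1" and "i \<in> {1, 2}"
    and "\<Sigma> \<subseteq> edges (hammock l w i)"
  shows "(mincut (hammock l w i) \<Sigma> \<longrightarrow> minpath (dual_hammock l w i) (compl_edge ` \<Sigma>)) \<and>
         (minpath (hammock l w i) \<Sigma> \<longrightarrow> mincut (dual_hammock l w i) (compl_edge ` \<Sigma>))"
proof -
  have \<Sigma>: "\<Sigma> \<subseteq> hammock_edges l w i"
    using assms(4) by (simp add: hammock_sel)
  have remove: "compl_edge ` \<Sigma> - {compl_edge e} = compl_edge ` (\<Sigma> - {e})"
    if "e \<in> \<Sigma>" for e
  proof -
    have "inj_on compl_edge \<Sigma>"
      using bij_betw_compl_edge[OF assms(3), of l w] \<Sigma> by (meson bij_betw_def inj_on_subset)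
    then show ?thesis
      using that by (auto simp: inj_on_def)
  qed
  have sub: "\<Sigma> - {e} \<subseteq> hammock_edges l w i" for e
    using \<Sigma> by blast
  note cut = cutset_iff_dual_pathset[OF assms(1-3)] and path = pathset_iff_dual_cutset[OF assms(1-3)]
  show ?thesis
    unfolding mincut_def minpath_def
    using cut[OF \<Sigma>] path[OF \<Sigma>] cut[OF sub] path[OF sub] remove by auto
qed

end
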